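(* Let $F$ be a field of characteristic zero and let $g:\mathbb{Z}\to F$ be an additive and injective map. For any Lie algebra automorphism $\theta\in \mathrm{Aut}(W(g,1))$ there are scalars $C_j\in F$ ($j\in\mathbb{Z}$, only finitely many nonzero) such that $$\theta\left(\binom{0}{1}_1\right)=\sum_j C_j\binom{0}{j}_1 .$$
   Context: Definition of $W(g,1)$. It is the Lie algebra over $F$ with basis $\left\{\binom{a}{i}_1 : a,i\in\mathbb{Z}\right\}$ (formal symbols, not binomial coefficients) and with bracket the bilinear extension of $$\left[\binom{a}{i}_1,\binom{b}{j}_1\right]=\big(g(b)-g(a)\big)\binom{a+b}{i+j}_1+(j-i)\binom{a+b}{i+j-1}_1 ,$$ where the integer $j-i$ is regarded as an element of $F$. *)

theory Defs
  imports Complex_Main "HOL-Library.Poly_Mapping"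
begin

locale lie_algebra = vector_space scale
  for scale :: "'f::field \<Rightarrow> 'v::ab_group_add \<Rightarrow> 'v" +
  fixes bracket :: "'v \<Rightarrow> 'v \<Rightarrow> 'v"
  assumes bracket_linear_left: "Vector_Spaces.linear scale scale (\<lambda>x. bracket x y)"
    and bracket_linear_right: "Vector_Spaces.linear scale scale (\<lambda>y. bracket x y)"
    and bracket_self: "bracket x x = 0"
    and jacobi: "bracket x (bracket y z) + bracket y (bracket z x) + bracket z (bracket x y) = 0"

definition lie_automorphism ::
    "('f::field \<Rightarrow> 'v::ab_group_add \<Rightarrow> 'v) \<Rightarrow> ('v \<Rightarrow> 'v \<Rightarrow> 'v) \<Rightarrow> ('v \<Rightarrow> 'v) \<Rightarrow> bool" where
  "lie_automorphism scale bracket \<theta> \<longleftrightarrow>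
     Vector_Spaces.linear scale scale \<theta> \<and> bij \<theta> \<and>
     (\<forall>x y. \<theta> (bracket x y) = bracket (\<theta> x) (\<theta> y))"

text \<open>
  The underlying vector space is the free one on \<open>\<int> \<times> \<int>\<close>, i.e. the finitely supported
  functions; the pair \<open>(a, i)\<close> stands for the formal symbol with upper entry \<open>a\<close> and
  lower entry \<open>i\<close>.
\<close>

type_synonym 'f W = "(int \<times> int) \<Rightarrow>\<^sub>0 'f"

definition W_scale :: "'f::field \<Rightarrow> 'f W \<Rightarrow> 'f W" where
  "W_scale c x = Poly_Mapping.map ((*) c) x"

definition W_basis :: "int \<Rightarrow> int \<Rightarrow> ('f::field) W" where
  "W_basis a i = Poly_Mapping.single (a, i) 1"

fun W_basis_bracket :: "(int \<Rightarrow> 'f::field) \<Rightarrow> int \<times> int \<Rightarrow> int \<times> int \<Rightarrow> 'f W" where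
  "W_basis_bracket g (a, i) (b, j) =
     W_scale (g b - g a) (W_basis (a + b) (i + j))
     + W_scale (of_int (j - i)) (W_basis (a + b) (i + j - 1))"

definition W_bracket :: "(int \<Rightarrow> 'f::field) \<Rightarrow> 'f W \<Rightarrow> 'f W \<Rightarrow> 'f W" where
  "W_bracket g x y =
     (\<Sum>p\<in>Poly_Mapping.keys x. \<Sum>q\<in>Poly_Mapping.keys y.
        W_scale (Poly_Mapping.lookup x p * Poly_Mapping.lookup y q) (W_basis_bracket g p q))"

lemma lookup_W_scale [simp]: "Poly_Mapping.lookup (W_scale c x) p = c * Poly_Mapping.lookup x p"
  unfolding W_scale_def by transfer (auto simp: when_def)

lemma vector_space_W: "vector_space (W_scale :: 'f::field \<Rightarrow> _)"
  by unfold_locales (auto intro!: poly_mapping_eqI simp: lookup_add algebra_simps)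

interpretation W: vector_space "W_scale :: 'f::field \<Rightarrow> _"
  by (rule vector_space_W)

lemma W_linearI:
  assumes "\<And>x y. f (x + y) = f x + f y" "\<And>c x. f (W_scale c x) = W_scale c (f x)"
  shows "Vector_Spaces.linear W_scale W_scale f"
  by (simp add: assms Vector_Spaces.linear_def module_hom_def module_hom_axioms_def
      vector_space_W W.module_axioms)

lemma W_bracket_superset:
  assumes "finite A" "finite B" "Poly_Mapping.keys x \<subseteq> A" "Poly_Mapping.keys y \<subseteq> B"
  shows "W_bracket g x y = (\<Sum>p\<in>A. \<Sum>q\<in>B.
    W_scale (Poly_Mapping.lookup x p * Poly_Mapping.lookup y q) (W_basis_bracket g p q))"
proof -
  have "W_bracket g x y = (\<Sum>p\<in>Poly_Mapping.keys x. \<Sum>q\<in>B.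
      W_scale (Poly_Mapping.lookup x p * Poly_Mapping.lookup y q) (W_basis_bracket g p q))"
    unfolding W_bracket_def
    by (intro sum.cong refl sum.mono_neutral_left assms) (auto simp: in_keys_iff)
  also have "\<dots> = (\<Sum>p\<in>A. \<Sum>q\<in>B.
      W_scale (Poly_Mapping.lookup x p * Poly_Mapping.lookup y q) (W_basis_bracket g p q))"
    by (intro sum.mono_neutral_left assms) (auto simp: in_keys_iff)
  finally show ?thesis .
qed

lemma keys_W_scale: "Poly_Mapping.keys (W_scale c x) \<subseteq> Poly_Mapping.keys x"
  by (auto simp: in_keys_iff)

lemma W_bracket_add_left: "W_bracket g (x + y) z = W_bracket g x z + W_bracket g y z"
  by (simp add: W_bracket_superset
      [where A = "Poly_Mapping.keys x \<union> Poly_Mapping.keys y" and B = "Poly_Mapping.keys z"]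
      keys_add lookup_add algebra_simps sum.distrib)

lemma W_bracket_add_right: "W_bracket g z (x + y) = W_bracket g z x + W_bracket g z y"
  by (simp add: W_bracket_superset
      [where B = "Poly_Mapping.keys x \<union> Poly_Mapping.keys y" and A = "Poly_Mapping.keys z"]
      keys_add lookup_add algebra_simps sum.distrib)

lemma W_bracket_scale_left: "W_bracket g (W_scale c x) z = W_scale c (W_bracket g x z)"
  by (simp add: W_bracket_superset
      [where A = "Poly_Mapping.keys x" and B = "Poly_Mapping.keys z"]
      keys_W_scale W.scale_sum_right mult.assoc)

lemma W_bracket_scale_right: "W_bracket g z (W_scale c x) = W_scale c (W_bracket g z x)"
  by (simp add: W_bracket_superset
      [where B = "Poly_Mapping.keys x" and A = "Poly_Mapping.keys z"]
      keys_W_scale W.scale_sum_right mult.left_commute)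

lemma W_bracket_zero [simp]: "W_bracket g 0 x = 0" "W_bracket g x 0 = 0"
  by (simp_all add: W_bracket_def)

lemma W_bracket_basis:
  "W_bracket g (W_basis a i) (W_basis b j) =
     W_scale (g b - g a) (W_basis (a + b) (i + j))
     + W_scale (of_int (j - i)) (W_basis (a + b) (i + j - 1))"
  by (simp add: W_bracket_def W_basis_def)

lemma W_induct [case_names zero add basis]:
  assumes "P 0" "\<And>x y. P x \<Longrightarrow> P y \<Longrightarrow> P (x + y)" "\<And>c a i. P (W_scale c (W_basis a i))"
  shows "P (x :: ('f::field) W)"
proof (induction x rule: update_induct)
  case const
  show ?case by (fact assms(1))
next
  case (update f p c)
  obtain a i where p: "p = (a, i)" by force
  have "Poly_Mapping.update p c f = f + W_scale c (W_basis a i)"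
    using update(1)
    by (intro poly_mapping_eqI)
       (auto simp: lookup_add lookup_update W_basis_def lookup_single p when_def in_keys_iff)
  with update assms show ?case by simp
qed

lemma W_bracket_antisym: "W_bracket g x y = - W_bracket g y x"
proof -
  have basis: "W_basis_bracket g p q = - W_basis_bracket g q p" for p q
    by (cases p; cases q)
       (auto intro!: poly_mapping_eqI simp: lookup_add algebra_simps)
  have "W_bracket g x y =
     (\<Sum>q\<in>Poly_Mapping.keys y. \<Sum>p\<in>Poly_Mapping.keys x.
        W_scale (Poly_Mapping.lookup x p * Poly_Mapping.lookup y q) (W_basis_bracket g p q))"
    unfolding W_bracket_def by (rule sum.swap)
  also have "\<dots> = - W_bracket g y x"
    unfolding W_bracket_def sum_negf[symmetric]
    by (intro sum.cong refl) (subst basis, simp add: mult.commute)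
  finally show ?thesis .
qed

lemma W_bracket_self: "W_bracket (g :: int \<Rightarrow> 'f::field_char_0) x x = 0"
proof (rule poly_mapping_eqI)
  fix p
  have "Poly_Mapping.lookup (W_bracket g x x) p = - Poly_Mapping.lookup (W_bracket g x x) p"
    by (subst W_bracket_antisym) simp
  then show "Poly_Mapping.lookup (W_bracket g x x) p = Poly_Mapping.lookup 0 p"
    by (simp add: eq_neg_iff_add_eq_0 flip: mult_2)
qed

lemma W_jacobi_basis:
  assumes "Modules.additive g"
  shows "W_bracket g (W_basis a i) (W_bracket g (W_basis b j) (W_basis c k))
    + W_bracket g (W_basis b j) (W_bracket g (W_basis c k) (W_basis a i))
    + W_bracket g (W_basis c k) (W_bracket g (W_basis a i) (W_basis b j)) = 0"
proof -
  define B where "B m = (W_basis (a + b + c) (i + j + k - m) :: 'a W)" for m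
  have B: "W_basis (a + (b + c)) (i + (j + k)) = B 0"
    "W_basis (a + (b + c)) (i + (j + k) - 1) = B 1"
    "W_basis (a + (b + c)) (i + (j + k - 1)) = B 1"
    "W_basis (a + (b + c)) (i + (j + k - 1) - 1) = B 2"
    "W_basis (b + (c + a)) (j + (k + i)) = B 0"
    "W_basis (b + (c + a)) (j + (k + i) - 1) = B 1"
    "W_basis (b + (c + a)) (j + (k + i - 1)) = B 1"
    "W_basis (b + (c + a)) (j + (k + i - 1) - 1) = B 2"
    "W_basis (c + (a + b)) (k + (i + j)) = B 0"
    "W_basis (c + (a + b)) (k + (i + j) - 1) = B 1"
    "W_basis (c + (a + b)) (k + (i + j - 1)) = B 1"
    "W_basis (c + (a + b)) (k + (i + j - 1) - 1) = B 2"
    by (simp_all add: B_def algebra_simps)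
  show ?thesis
    unfolding W_bracket_basis W_bracket_add_right W_bracket_scale_right B
    by (rule poly_mapping_eqI)
       (simp add: lookup_add Modules.additive.add[OF assms] algebra_simps)
qed

lemma W_jacobi:
  assumes "Modules.additive g"
  shows "W_bracket g x (W_bracket g y z) + W_bracket g y (W_bracket g z x)
    + W_bracket g z (W_bracket g x y) = 0"
proof -
  define J where "J x y z = W_bracket g x (W_bracket g y z) + W_bracket g y (W_bracket g z x)
    + W_bracket g z (W_bracket g x y)" for x y z
  note bil = W_bracket_add_left W_bracket_add_right W_bracket_scale_left W_bracket_scale_right
  have add: "J (x + x') y z = J x y z + J x' y z" "J x (y + y') z = J x y z + J x y' z"
    "J x y (z + z') = J x y z + J x y z'" for x x' y y' z z'
    by (simp_all add: J_def bil)
  have scale: "J (W_scale c x) y z = W_scale c (J x y z)"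
    "J x (W_scale c y) z = W_scale c (J x y z)" "J x y (W_scale c z) = W_scale c (J x y z)"
    for c x y z
    by (simp_all add: J_def bil W.scale_right_distrib)
  have zero: "J 0 y z = 0" "J x 0 z = 0" "J x y 0 = 0" for x y z
    by (simp_all add: J_def)
  have basis: "J (W_basis a i) (W_basis b j) (W_basis c k) = 0" for a i b j c k
    unfolding J_def by (rule W_jacobi_basis[OF assms])
  have "J (W_basis a i) (W_basis b j) z = 0" for a i b j
    by (induction z rule: W_induct) (simp_all add: add zero scale basis)
  then have "J (W_basis a i) y z = 0" for a i
    by (induction y rule: W_induct) (simp_all add: add zero scale)
  then have "J x y z = 0"
    by (induction x rule: W_induct) (simp_all add: add zero scale)
  then show ?thesis by (simp add: J_def)
qed

theorem lie_algebra_W: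
  fixes g :: "int \<Rightarrow> 'f::field_char_0"
  assumes "Modules.additive g"
  shows "lie_algebra W_scale (W_bracket g)"
  by (intro lie_algebra.intro vector_space_W lie_algebra_axioms.intro W_linearI
      W_bracket_add_left W_bracket_add_right W_bracket_scale_left W_bracket_scale_right
      W_bracket_self W_jacobi assms)

end

theory Submission
  imports
    Defs
    "HOL-Library.Product_Plus"
    "HOL-Library.Product_Lexorder"
    "HOL-Analysis.Continuum_Not_Denumerable"
begin

text \<open>
  Let \<open>A\<close> be the group algebra of \<open>\<int> \<times> \<int>\<close>, that is the Laurent polynomials in two variables
  \<open>t\<close> and \<open>x\<close>, with \<open>t\<^sup>a x\<^sup>i\<close> standing for the basis vector \<open>(a, i)\<close>. It carries the derivation
  \<open>D\<close> with \<open>D x = 1\<close> and \<open>D t = g(1) t\<close>, and the bracket of the Lie algebra is the Wronskian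
  \<open>[u, v] = u D v - D u v\<close>. So the Lie algebra consists of the vector fields \<open>u D\<close>.

  The only property of \<open>f = \<theta>(x)\<close> that matters is that every integer is an eigenvalue of \<open>ad f\<close>:
  since \<open>[x, x\<^bsup>n+1\<^esup>] = n x\<^bsup>n+1\<^esup>\<close>, the elements \<open>h\<^sub>n = \<theta>(x\<^bsup>n+1\<^esup>)\<close> satisfy \<open>[f, h\<^sub>n] = n h\<^sub>n\<close>,
  and \<open>h\<^sub>0 = f\<close>. In the fraction field of \<open>A\<close>, the quotients \<open>h\<^sub>n / f\<close> solve \<open>f D y = n y\<close>.
  The constants of \<open>D\<close> are the scalars (\<open>commute_imp_multiple\<close>), so \<open>h\<^sub>n / f\<close> is a multiple of
  \<open>y\<^sup>n\<close> with \<open>y = h\<^sub>1 / f\<close> (\<open>eigenvector_mult\<close>, with denominators cleared). Thus all powers of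
  \<open>y\<close>, positive and negative, have the common denominator \<open>f\<close>. This forces \<open>y\<close> to be a unit
  of \<open>A\<close>, that is a scalar times a monomial \<open>t\<^sup>a x\<^sup>i\<close> (\<open>geometric_ratio_monomial\<close>). Now
  \<open>f D y = y\<close> reads \<open>f (g(a) + i x\<^bsup>-1\<^esup>) = 1\<close>. The second factor is free of \<open>t\<close>, hence so is its
  inverse \<open>f\<close>, and this is the claim.

  That \<open>y\<close> is a monomial is shown without unique factorization, by comparing the extremal
  exponents of \<open>h\<^sub>n\<close> with respect to an injective additive weight \<open>\<int> \<times> \<int> \<rightarrow> \<real>\<close>.
  The largest and the smallest exponent of \<open>h\<^sub>n\<close> both move linearly with \<open>n\<close>; since the former
  stays above the latter for all integers \<open>n\<close>, they move with the same slope. Dividing by a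
  monomial makes this slope zero, and then every power of \<open>y\<close> times \<open>f\<close> has its exponents in
  one fixed bounded interval of weights. If \<open>y\<close>, scaled to have leading coefficient quotient
  \<open>1\<close>, were not equal to \<open>1\<close>, then \<open>f (y - 1)\<^sup>n\<close> would have leading weight tending to
  \<open>-\<infinity>\<close> and yet exponents in that interval.
\<close>

section \<open>Leading exponents\<close>

text \<open>
  For exponents in \<open>\<int> \<times> \<int>\<close> this makes the lexicographic order translation invariant, which
  also supplies the fact that the Laurent polynomial ring has no zero divisors.
\<close>

instance prod :: (linordered_ab_group_add, linordered_ab_group_add) linordered_ab_group_add
  by standard (auto simp: less_eq_prod_def)

text \<open>
  The order on exponents is pulled back along a weight \<open>w\<close>, because two different orders on
  \<open>\<int> \<times> \<int>\<close> are needed: the lexicographic one, and an archimedean one coming from \<open>\<real>\<close>. Trailing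
  exponents are leading ones for \<open>-w\<close>.
\<close>

definition leading :: "('k \<Rightarrow> 'w::linorder) \<Rightarrow> ('k \<Rightarrow>\<^sub>0 'f::zero) \<Rightarrow> 'k \<Rightarrow> bool" where
  "leading w x p \<longleftrightarrow>
     p \<in> Poly_Mapping.keys x \<and> (\<forall>q\<in>Poly_Mapping.keys x. q \<noteq> p \<longrightarrow> w q < w p)"

lemma leading_in_keys: "leading w x p \<Longrightarrow> p \<in> Poly_Mapping.keys x"
  by (simp add: leading_def)

lemma leading_le: "leading w x p \<Longrightarrow> q \<in> Poly_Mapping.keys x \<Longrightarrow> w q \<le> w p"
  by (auto simp: leading_def le_less)

lemma leading_unique: "leading w x p \<Longrightarrow> leading w x q \<Longrightarrow> p = q"
  unfolding leading_def by (metis order_less_asym)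

lemma leading_exists:
  assumes "x \<noteq> 0" "inj w"
  obtains p where "leading w x p"
proof -
  let ?S = "w ` Poly_Mapping.keys x"
  have "Max ?S \<in> ?S" using assms(1) by (intro Max_in) auto
  then obtain p where p: "p \<in> Poly_Mapping.keys x" "w p = Max ?S" by auto
  have "w q < w p" if "q \<in> Poly_Mapping.keys x" "q \<noteq> p" for q
  proof -
    have "w q \<le> w p" unfolding p(2) using that(1) by simp
    moreover have "w q \<noteq> w p" using that(2) assms(2) by (auto dest: injD)
    ultimately show ?thesis by simp
  qed
  then have "leading w x p" using p(1) by (simp add: leading_def)
  then show thesis by (rule that)
qed

lemma leading_scale: "c \<noteq> 0 \<Longrightarrow> leading w (W_scale c x) p \<longleftrightarrow> leading w x p"
  by (simp add: leading_def in_keys_iff Ball_def)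

text \<open>
  Splitting both factors into leading term and rest, only the product of the two leading terms
  reaches the weight \<open>w (p + q)\<close>.
\<close>

lemma leading_mult:
  fixes x y :: "'k::ab_group_add \<Rightarrow>\<^sub>0 'f::field" and w :: "'k \<Rightarrow> 'w::linordered_ab_group_add"
  assumes w: "Modules.additive w" and x: "leading w x p" and y: "leading w y q"
  shows "leading w (x * y) (p + q)"
    and "Poly_Mapping.lookup (x * y) (p + q) = Poly_Mapping.lookup x p * Poly_Mapping.lookup y q"
proof -
  define X where "X = x - Poly_Mapping.single p (Poly_Mapping.lookup x p)"
  define Y where "Y = y - Poly_Mapping.single q (Poly_Mapping.lookup y q)"
  let ?m = "Poly_Mapping.single p (Poly_Mapping.lookup x p)"
  let ?n = "Poly_Mapping.single q (Poly_Mapping.lookup y q)"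
  let ?R = "?m * Y + X * ?n + X * Y"
  have lookX: "Poly_Mapping.lookup X k = (if k = p then 0 else Poly_Mapping.lookup x k)" for k
    by (simp add: X_def lookup_minus lookup_single)
  have lookY: "Poly_Mapping.lookup Y k = (if k = q then 0 else Poly_Mapping.lookup y k)" for k
    by (simp add: Y_def lookup_minus lookup_single)
  have X: "w k < w p" if "k \<in> Poly_Mapping.keys X" for k
    using that x by (auto simp: leading_def in_keys_iff lookX split: if_splits)
  have Y: "w k < w q" if "k \<in> Poly_Mapping.keys Y" for k
    using that y by (auto simp: leading_def in_keys_iff lookY split: if_splits)
  have split: "x * y = Poly_Mapping.single (p + q)
      (Poly_Mapping.lookup x p * Poly_Mapping.lookup y q) + ?R"
  proof -
    have "x * y = (?m + X) * (?n + Y)" by (simp add: X_def Y_def)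
    then show ?thesis by (simp add: algebra_simps mult_single)
  qed
  have R: "w k < w (p + q)" if "k \<in> Poly_Mapping.keys ?R" for k
  proof -
    have "k \<in> Poly_Mapping.keys (?m * Y) \<union> Poly_Mapping.keys (X * ?n) \<union> Poly_Mapping.keys (X * Y)"
      using that keys_add[of "?m * Y + X * ?n" "X * Y"] keys_add[of "?m * Y" "X * ?n"] by blast
    moreover have "Poly_Mapping.keys ?m \<subseteq> {p}" "Poly_Mapping.keys ?n \<subseteq> {q}" by auto
    ultimately obtain a b where "k = a + b"
      "a = p \<and> b \<in> Poly_Mapping.keys Y \<or> a \<in> Poly_Mapping.keys X \<and> b = q
        \<or> a \<in> Poly_Mapping.keys X \<and> b \<in> Poly_Mapping.keys Y"
      using keys_mult[of ?m Y] keys_mult[of X ?n] keys_mult[of X Y] by blast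
    then show ?thesis
      using X Y by (auto simp: Modules.additive.add[OF w] intro: add_strict_mono)
  qed
  have R0: "Poly_Mapping.lookup ?R (p + q) = 0"
    using R[of "p + q"] by (auto simp: in_keys_iff simp del: lookup_add)
  show look: "Poly_Mapping.lookup (x * y) (p + q) = Poly_Mapping.lookup x p * Poly_Mapping.lookup y q"
    unfolding split lookup_add[of "Poly_Mapping.single _ _"] R0 by simp
  have "w k < w (p + q)" if "k \<in> Poly_Mapping.keys (x * y)" "k \<noteq> p + q" for k
  proof (rule R)
    have "Poly_Mapping.lookup (x * y) k = Poly_Mapping.lookup ?R k"
      unfolding split lookup_add[of "Poly_Mapping.single _ _"]
      using that(2) by (simp add: lookup_single)
    with that(1) show "k \<in> Poly_Mapping.keys ?R" by (simp add: in_keys_iff)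
  qed
  moreover have "p + q \<in> Poly_Mapping.keys (x * y)"
    using leading_in_keys[OF x] leading_in_keys[OF y] look by (simp add: in_keys_iff)
  ultimately show "leading w (x * y) (p + q)" by (simp add: leading_def)
qed

section \<open>The bracket as a Wronskian\<close>

lemma W_scale_eq_mult: "W_scale c x = Poly_Mapping.single 0 c * x"
proof (induction x rule: W_induct)
  case (basis d a i)
  have "W_scale c (W_scale d (W_basis a i)) = Poly_Mapping.single (a, i) (c * d)"
    "W_scale d (W_basis a i) = Poly_Mapping.single (a, i) d"
    by (auto intro!: poly_mapping_eqI simp: W_basis_def lookup_single when_def)
  then show ?case by (simp add: mult_single)
qed (simp_all add: W.scale_right_distrib distrib_left)

lemma W_basis_mult: "W_basis a i * W_basis b j = W_basis (a + b) (i + j)"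
  by (simp add: W_basis_def mult_single)

lemma W_basis_0_0: "W_basis 0 0 = 1"
  by (rule poly_mapping_eqI) (auto simp: W_basis_def lookup_single lookup_one when_def zero_prod_def)

lemma W_scale_mult: "W_scale c x * y = W_scale c (x * y)" "x * W_scale c y = W_scale c (x * y)"
  by (simp_all add: W_scale_eq_mult algebra_simps)

text \<open>
  The unit \<open>1\<close> is the basis vector \<open>(0, 0)\<close>, that is the vector field \<open>D\<close> itself, so that
  its adjoint action is \<open>v D \<mapsto> (D v) D\<close>.
\<close>

definition deriv :: "(int \<Rightarrow> 'f::field) \<Rightarrow> 'f W \<Rightarrow> 'f W" where
  "deriv g = W_bracket g 1"

lemma deriv_linear:
  "deriv g (x + y) = deriv g x + deriv g y" "deriv g (W_scale c x) = W_scale c (deriv g x)"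
  "deriv g 0 = 0"
  by (simp_all add: deriv_def W_bracket_add_right W_bracket_scale_right)

lemma deriv_basis:
  assumes "Modules.additive g"
  shows "deriv g (W_basis a i) = W_scale (g a) (W_basis a i) + W_scale (of_int i) (W_basis a (i - 1))"
  by (simp add: deriv_def W_bracket_basis Modules.additive.zero[OF assms] flip: W_basis_0_0)

lemma deriv_mult:
  assumes g: "Modules.additive g"
  shows "deriv g (x * y) = deriv g x * y + x * deriv g y"
proof -
  have basis: "deriv g (W_basis a i * W_basis b j) =
      deriv g (W_basis a i) * W_basis b j + W_basis a i * deriv g (W_basis b j)" for a i b j
    by (rule poly_mapping_eqI)
      (simp add: W_basis_mult deriv_basis[OF g] distrib_left distrib_right W_scale_mult lookup_add
        Modules.additive.add[OF g] algebra_simps)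
  have "deriv g (W_basis a i * y) = deriv g (W_basis a i) * y + W_basis a i * deriv g y" for a i
    by (induction y rule: W_induct)
      (simp_all add: deriv_linear distrib_left W_scale_mult basis W.scale_right_distrib)
  then show ?thesis
    by (induction x rule: W_induct)
      (simp_all add: deriv_linear distrib_right W_scale_mult W.scale_right_distrib)
qed

lemma W_bracket_eq_wronskian:
  assumes g: "Modules.additive g"
  shows "W_bracket g x y = x * deriv g y - deriv g x * y"
proof -
  have basis: "W_bracket g (W_basis a i) (W_basis b j) =
      W_basis a i * deriv g (W_basis b j) - deriv g (W_basis a i) * W_basis b j" for a i b j
    by (rule poly_mapping_eqI)
      (simp add: W_basis_mult W_bracket_basis deriv_basis[OF g] distrib_left distrib_right
        W_scale_mult lookup_add lookup_minus algebra_simps)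
  have "W_bracket g (W_basis a i) y = W_basis a i * deriv g y - deriv g (W_basis a i) * y" for a i
    by (induction y rule: W_induct)
      (simp_all add: deriv_linear distrib_left W_scale_mult basis W.scale_right_diff_distrib
        W_bracket_add_right W_bracket_scale_right)
  then show ?thesis
    by (induction x rule: W_induct)
      (simp_all add: deriv_linear distrib_right W_scale_mult W.scale_right_diff_distrib
        W_bracket_add_left W_bracket_scale_left)
qed

section \<open>Centralizers\<close>

lemma lookup_W_basis_bracket:
  "Poly_Mapping.lookup (W_basis_bracket g p q) s =
     (if p + q = s then g (fst q) - g (fst p) else 0)
     + (if p + q = s + (0, 1) then of_int (snd q - snd p) else 0)"
  by (cases p; cases q; cases s) (auto simp: lookup_add W_basis_def lookup_single when_def)

lemma lookup_W_bracket:
  "Poly_Mapping.lookup (W_bracket g x y) s =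
     (\<Sum>p\<in>Poly_Mapping.keys x. \<Sum>q\<in>Poly_Mapping.keys y.
        Poly_Mapping.lookup x p * Poly_Mapping.lookup y q
          * Poly_Mapping.lookup (W_basis_bracket g p q) s)"
  by (simp add: W_bracket_def lookup_sum)

lemma lookup_W_bracket_single_contribution:
  assumes "p \<in> Poly_Mapping.keys x" "q \<in> Poly_Mapping.keys y"
    and other: "\<And>p' q'. p' \<in> Poly_Mapping.keys x \<Longrightarrow> q' \<in> Poly_Mapping.keys y \<Longrightarrow> (p', q') \<noteq> (p, q)
      \<Longrightarrow> Poly_Mapping.lookup (W_basis_bracket g p' q') s = 0"
  shows "Poly_Mapping.lookup (W_bracket g x y) s =
    Poly_Mapping.lookup x p * Poly_Mapping.lookup y q
      * Poly_Mapping.lookup (W_basis_bracket g p q) s" (is "_ = ?c")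
proof -
  have "Poly_Mapping.lookup (W_bracket g x y) s =
     (\<Sum>p'\<in>Poly_Mapping.keys x. \<Sum>q'\<in>Poly_Mapping.keys y.
        if p' = p then if q' = q then ?c else 0 else 0)"
    unfolding lookup_W_bracket by (intro sum.cong refl) (use other in auto)
  also have "\<dots> = ?c" using assms(1,2) by (simp add: sum.If_cases)
  finally show ?thesis .
qed

text \<open>
  Let \<open>p = (a, i)\<close> and \<open>q = (b, j)\<close>. The coefficient of the bracket at \<open>p + q\<close> is a nonzero
  multiple of \<open>g b - g a\<close>, which yields \<open>a = b\<close>. The next coefficient, at \<open>p + q - (0, 1)\<close>, could
  also receive contributions \<open>g b' - g a'\<close> from smaller pairs of exponents; but the lexicographic
  order compares first components first, so that such pairs have \<open>a' = a\<close> and \<open>b' = b\<close> and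
  contribute zero. Hence \<open>j - i\<close> vanishes as well. An archimedean order would not allow this
  conclusion.
\<close>

lemma leading_eq_if_commute:
  fixes g :: "int \<Rightarrow> 'f::field_char_0"
  assumes g: "inj g"
    and x: "leading (\<lambda>k. k) x p" and y: "leading (\<lambda>k. k) y q"
    and xy: "W_bracket g x y = 0"
  shows "p = q"
proof -
  have pq: "p \<in> Poly_Mapping.keys x" "q \<in> Poly_Mapping.keys y"
    using x y by (simp_all add: leading_def)
  have nz: "Poly_Mapping.lookup x p * Poly_Mapping.lookup y q \<noteq> 0"
    using pq by (simp add: in_keys_iff)
  have le: "p' \<le> p" "q' \<le> q" if "p' \<in> Poly_Mapping.keys x" "q' \<in> Poly_Mapping.keys y" for p' q'
    using leading_le[OF x that(1)] leading_le[OF y that(2)] by simp_all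
  have eq: "p' = p \<and> q' = q" if "p' \<in> Poly_Mapping.keys x" "q' \<in> Poly_Mapping.keys y"
    "p' + q' = p + q" for p' q'
    using le[OF that(1,2)] that(3)
    by (metis add_less_le_mono add_le_less_mono order_le_imp_less_or_eq order_less_irrefl)
  have "Poly_Mapping.lookup (W_bracket g x y) (p + q) =
    Poly_Mapping.lookup x p * Poly_Mapping.lookup y q
      * Poly_Mapping.lookup (W_basis_bracket g p q) (p + q)"
  proof (rule lookup_W_bracket_single_contribution[OF pq])
    fix p' q' assume *: "p' \<in> Poly_Mapping.keys x" "q' \<in> Poly_Mapping.keys y" "(p', q') \<noteq> (p, q)"
    have "p' + q' \<noteq> p + q + (0, 1)"
      using add_mono[OF le[OF *(1,2)]] by (auto simp: less_eq_prod_def prod_eq_iff)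
    then show "Poly_Mapping.lookup (W_basis_bracket g p' q') (p + q) = 0"
      using eq[OF *(1,2)] *(3) by (auto simp: lookup_W_basis_bracket)
  qed
  then have "g (fst q) = g (fst p)"
    using nz xy by (simp add: lookup_W_basis_bracket prod_eq_iff)
  then have fst: "fst q = fst p" using g by (auto dest: injD)
  have "Poly_Mapping.lookup (W_bracket g x y) (p + q - (0, 1)) =
    Poly_Mapping.lookup x p * Poly_Mapping.lookup y q
      * Poly_Mapping.lookup (W_basis_bracket g p q) (p + q - (0, 1))"
  proof (rule lookup_W_bracket_single_contribution[OF pq])
    fix p' q' assume *: "p' \<in> Poly_Mapping.keys x" "q' \<in> Poly_Mapping.keys y" "(p', q') \<noteq> (p, q)"
    \<comment> \<open>Both first components are at most that of \<open>p\<close>, and their sum is twice that.\<close>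
    have "fst p' = fst q'" if "p' + q' = p + q - (0, 1)"
      using le[OF *(1,2)] that fst by (auto simp: less_eq_prod_def prod_eq_iff)
    then show "Poly_Mapping.lookup (W_basis_bracket g p' q') (p + q - (0, 1)) = 0"
      using eq[OF *(1,2)] *(3) by (auto simp: lookup_W_basis_bracket)
  qed
  then have "(of_int (snd q - snd p) :: 'f) = 0"
    using nz xy by (simp add: lookup_W_basis_bracket fst zero_prod_def)
  then have "snd q = snd p" by (metis eq_iff_diff_eq_0 of_int_eq_0_iff)
  with fst show ?thesis by (simp add: prod_eq_iff)
qed

text \<open>
  A commuting pair has equal leading exponents. Subtracting from \<open>x\<close> the multiple of \<open>y\<close> with the
  same leading coefficient leaves an element that still commutes with \<open>y\<close> but has lost this
  exponent, so it is zero. In terms of \<open>D\<close>: a quotient \<open>x / y\<close> with derivative zero is a scalar.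
\<close>

lemma commute_imp_multiple:
  fixes g :: "int \<Rightarrow> 'f::field_char_0"
  assumes g: "inj g" and xy: "W_bracket g x y = 0" and y: "y \<noteq> 0"
  obtains c where "x = W_scale c y"
proof (cases "x = 0")
  case True
  then show thesis using that[of 0] by simp
next
  case False
  obtain p where p: "leading (\<lambda>k. k) x p" using leading_exists[OF False] by (metis inj_on_id2)
  obtain q where q: "leading (\<lambda>k. k) y q" using leading_exists[OF y] by (metis inj_on_id2)
  have pq: "p = q" by (rule leading_eq_if_commute[OF g p q xy])
  define c where "c = Poly_Mapping.lookup x p / Poly_Mapping.lookup y p"
  define z where "z = x + W_scale (- c) y"
  have zy: "W_bracket g z y = 0"
    by (simp add: z_def W_bracket_add_left W_bracket_scale_left W_bracket_self xy
        del: W.scale_minus_left)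
  have "Poly_Mapping.lookup y p \<noteq> 0" using leading_in_keys[OF q] pq by (simp add: in_keys_iff)
  then have zp: "Poly_Mapping.lookup z p = 0"
    by (simp add: z_def c_def lookup_add del: W.scale_minus_left)
  have "z = 0"
  proof (rule ccontr)
    assume "z \<noteq> 0"
    then obtain r where r: "leading (\<lambda>k. k) z r" using leading_exists by (metis inj_on_id2)
    have "r = q" by (rule leading_eq_if_commute[OF g r q zy])
    with r zp pq show False by (auto simp: leading_def in_keys_iff)
  qed
  then show thesis using that[of c] by (simp add: z_def)
qed

text \<open>
  The eigenvector equation for \<open>a\<close> says that \<open>a / f\<close> solves \<open>f D y = \<alpha> y\<close>. Solutions for \<open>\<alpha>\<close> and
  \<open>\<beta>\<close> multiply to one for \<open>\<alpha> + \<beta>\<close>, and two solutions for the same eigenvalue have a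
  quotient with derivative zero.
\<close>

lemma eigenvector_mult:
  fixes g :: "int \<Rightarrow> 'f::field_char_0"
  assumes g: "Modules.additive g" "inj g" and nz: "f \<noteq> 0" "c \<noteq> 0"
    and a: "W_bracket g f a = W_scale \<alpha> a" and b: "W_bracket g f b = W_scale \<beta> b"
    and c: "W_bracket g f c = W_scale (\<alpha> + \<beta>) c"
  obtains k where "a * b = W_scale k (f * c)"
proof -
  let ?C = "Poly_Mapping.single 0 :: 'f \<Rightarrow> 'f W" and ?D = "deriv g"
  have C: "?C (\<alpha> + \<beta>) = ?C \<alpha> + ?C \<beta>" by (simp add: single_add)
  have A: "f * ?D a = ?D f * a + ?C \<alpha> * a" and B: "f * ?D b = ?D f * b + ?C \<beta> * b"
    and Cc: "f * ?D c = ?D f * c + (?C \<alpha> + ?C \<beta>) * c"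
    using a b c unfolding W_bracket_eq_wronskian[OF g(1)] W_scale_eq_mult C
    by (simp_all add: diff_eq_eq algebra_simps)
  have "f * W_bracket g (a * b) (f * c) =
      a * b * (f * ?D f * c + f * (f * ?D c))
      - ((f * ?D a) * b + a * (f * ?D b)) * (f * c)"
    unfolding W_bracket_eq_wronskian[OF g(1)] deriv_mult[OF g(1)] by (simp add: algebra_simps)
  also have "\<dots> = 0" unfolding A B Cc by (simp add: algebra_simps)
  finally have "W_bracket g (a * b) (f * c) = 0" using nz(1) by simp
  moreover have "f * c \<noteq> 0" using nz by simp
  ultimately show thesis using commute_imp_multiple[OF g(2)] that by blast
qed

section \<open>Geometric sequences of Laurent polynomials\<close>

text \<open>
  The relation \<open>h i * h j = c (h 0 * h (i + j))\<close>, with scalars \<open>c\<close> depending on \<open>i\<close> and \<open>j\<close>, says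
  that up to scalars \<open>h n\<close> is \<open>h 0\<close> times the \<open>n\<close>-th power of a fixed fraction.
\<close>

lemma additive_int_real:
  fixes \<phi> :: "int \<Rightarrow> real"
  assumes "Modules.additive \<phi>"
  shows "\<phi> n = of_int n * \<phi> 1"
proof (induction n rule: int_induct[where k = 0])
  case base
  show ?case by (simp add: Modules.additive.zero[OF assms])
next
  case (step1 i)
  then show ?case by (simp add: Modules.additive.add[OF assms] algebra_simps)
next
  case (step2 i)
  then show ?case by (simp add: Modules.additive.diff[OF assms] algebra_simps)
qed

text \<open>Any irrational slope gives such a weight.\<close>

lemma additive_real_weight_exists:
  obtains w :: "int \<times> int \<Rightarrow> real" where "Modules.additive w" "inj w"
proof -
  have "\<not> UNIV \<subseteq> (\<rat> :: real set)"
    using uncountable_UNIV_real countable_rat countable_subset by blast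
  then obtain r :: real where r: "r \<notin> \<rat>" by blast
  define w :: "int \<times> int \<Rightarrow> real" where "w = (\<lambda>(a, i). of_int i + of_int a * r)"
  have add: "Modules.additive w" by standard (auto simp: w_def algebra_simps)
  have "p = q" if "w p = w q" for p q
  proof -
    obtain a i b j where pq: "p = (a, i)" "q = (b, j)" by force
    have eq: "of_int (a - b) * r = of_int (j - i)"
      using that by (simp add: w_def pq algebra_simps)
    have "a = b"
    proof (rule ccontr)
      assume "a \<noteq> b"
      then have "r = of_int (j - i) / of_int (a - b)" using eq by (simp add: field_simps)
      then show False using r by (metis Rats_divide Rats_of_int)
    qed
    then show ?thesis using eq pq by simp
  qed
  then show thesis using add that by (blast intro: injI)
qed

lemma linear_bounded_below_imp_slope_zero:
  fixes d K :: real
  assumes "\<And>n::int. of_int n * d \<ge> K"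
  shows "d = 0"
proof (rule ccontr)
  assume "d \<noteq> 0"
  obtain n where n: "real_of_int n > \<bar>K\<bar> / \<bar>d\<bar>" using ex_less_of_int by blast
  then have "of_int n * \<bar>d\<bar> > \<bar>K\<bar>" using \<open>d \<noteq> 0\<close> by (simp add: field_simps)
  moreover have "of_int (- n) * d \<ge> K" "of_int n * d \<ge> K" using assms by blast+
  ultimately show False by (auto simp: abs_if split: if_splits)
qed

lemma geometric_leading:
  fixes h :: "int \<Rightarrow> 'f::field W" and w :: "int \<times> int \<Rightarrow> real"
  assumes w: "Modules.additive w" and nz: "\<And>n. h n \<noteq> 0"
    and mult: "\<And>i j. \<exists>c. h i * h j = W_scale c (h 0 * h (i + j))"
    and p: "\<And>n. leading w (h n) (p n)"
  shows "p i + p j = p 0 + p (i + j)"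
proof -
  obtain c where c: "h i * h j = W_scale c (h 0 * h (i + j))" using mult by blast
  have "c \<noteq> 0" using c nz by auto
  then have "leading w (h i * h j) (p 0 + p (i + j))"
    unfolding c by (simp add: leading_scale leading_mult(1)[OF w] p)
  moreover have "leading w (h i * h j) (p i + p j)" by (rule leading_mult(1)[OF w p p])
  ultimately show ?thesis by (rule leading_unique[rotated])
qed

text \<open>
  The span \<open>V\<close> of the sequence is mapped into itself by multiplication with the fraction
  \<open>h 1 / h 0\<close>, hence also by \<open>e / h 0\<close> where \<open>e = c h 1 - h 0\<close>. The constant \<open>c\<close> is chosen such that
  \<open>e\<close> loses the common leading exponent. If \<open>e\<close> were nonzero, each application would lower the
  leading weight by the same positive amount, although the weights in \<open>V\<close> are bounded below by \<open>L\<close>.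
\<close>

lemma geometric_ratio_monomial_balanced:
  fixes h :: "int \<Rightarrow> 'f::field W" and w :: "int \<times> int \<Rightarrow> real"
  assumes w: "Modules.additive w" "inj w"
    and mult: "\<And>i j. \<exists>c. h i * h j = W_scale c (h 0 * h (i + j))"
    and p: "\<And>n. leading w (h n) p" and l: "\<And>n k. k \<in> Poly_Mapping.keys (h n) \<Longrightarrow> L \<le> w k"
  shows "\<exists>c. h 0 = W_scale c (h 1)"
proof -
  define c where "c = Poly_Mapping.lookup (h 0) p / Poly_Mapping.lookup (h 1) p"
  define e where "e = W_scale c (h 1) - h 0"
  have p1: "Poly_Mapping.lookup (h 1) p \<noteq> 0"
    using leading_in_keys[OF p] by (simp add: in_keys_iff)
  have "e = 0"
  proof (rule ccontr)
    assume "e \<noteq> 0"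
    then obtain e0 where e0: "leading w e e0" using leading_exists w(2) by blast
    have "Poly_Mapping.lookup e p = 0" using p1 by (simp add: e_def c_def lookup_minus)
    then have "e0 \<noteq> p" using leading_in_keys[OF e0] by (auto simp: in_keys_iff)
    moreover have "e0 \<in> Poly_Mapping.keys (h 1) \<or> e0 \<in> Poly_Mapping.keys (h 0)"
      using leading_in_keys[OF e0] by (auto simp: e_def in_keys_iff lookup_minus)
    ultimately have drop: "w e0 < w p" using p unfolding leading_def by blast
    define V where "V = W.span (range h)"
    have keys_V: "L \<le> w k" if "x \<in> V" "k \<in> Poly_Mapping.keys x" for x k
      using that unfolding V_def
    proof (induction arbitrary: k rule: W.span_induct_alt)
      case (step d x y)
      then have "k \<in> Poly_Mapping.keys x \<or> k \<in> Poly_Mapping.keys y"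
        by (auto simp: in_keys_iff lookup_add)
      then show ?case using step.hyps(1) step.IH l by blast
    qed simp
    have step: "\<exists>y\<in>V. h 0 * y = e * x" if "x \<in> V" for x
      using that unfolding V_def
    proof (induction rule: W.span_induct_alt)
      case base
      show ?case by (rule bexI[of _ 0]) (auto intro: W.span_zero)
    next
      case (step d x y)
      then obtain n z where x: "x = h n" and z: "z \<in> W.span (range h)" "h 0 * z = e * y" by auto
      obtain k where k: "h 1 * h n = W_scale k (h 0 * h (1 + n))" using mult by blast
      have eh: "h 0 * (W_scale (c * k) (h (1 + n)) - h n) = e * h n"
        by (simp add: e_def left_diff_distrib right_diff_distrib W_scale_mult k)
      have "h 0 * (W_scale d (W_scale (c * k) (h (1 + n)) - h n) + z) = e * (W_scale d x + y)"
        by (simp only: x distrib_left distrib_right W_scale_mult eh z(2))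
      moreover have "W_scale d (W_scale (c * k) (h (1 + n)) - h n) + z \<in> W.span (range h)"
        by (intro W.span_add W.span_scale W.span_diff W.span_base z(1)) auto
      ultimately show ?case by blast
    qed
    have "\<exists>x\<in>V. \<exists>q. leading w x q \<and> w q = w p - of_nat n * (w p - w e0)" for n
    proof (induction n)
      case 0
      have "h 0 \<in> V" unfolding V_def by (intro W.span_base) auto
      with p[of 0] show ?case by (intro bexI[of _ "h 0"] exI[of _ p]) simp_all
    next
      case (Suc n)
      then obtain x q where x: "x \<in> V" "leading w x q"
        "w q = w p - of_nat n * (w p - w e0)" by blast
      obtain y where y: "y \<in> V" "h 0 * y = e * x" using step x(1) by blast
      have ex: "leading w (h 0 * y) (e0 + q)"
        unfolding y(2) by (rule leading_mult(1)[OF w(1) e0 x(2)])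
      then have "y \<noteq> 0" by (auto simp: leading_def)
      then obtain r where r: "leading w y r" using leading_exists w(2) by blast
      have "p + r = e0 + q" using leading_unique[OF leading_mult(1)[OF w(1) p r] ex] .
      then have "w p + w r = w e0 + w q" by (metis Modules.additive.add[OF w(1)])
      then have "w r = w p - of_nat (Suc n) * (w p - w e0)"
        using x(3) by (simp add: algebra_simps)
      with y(1) r show ?case by blast
    qed
    then have bound: "L \<le> w p - of_nat n * (w p - w e0)" for n :: nat
      using keys_V leading_in_keys by metis
    obtain n :: nat where "of_nat n * (w p - w e0) > w p - L"
      using drop reals_Archimedean3[of "w p - w e0"] by auto
    with bound[of n] show False by simp
  qed
  then have "h 0 = W_scale c (h 1)" by (simp add: e_def)
  then show ?thesis ..
qed

text \<open>
  The shifts \<open>u n\<close> and \<open>v n\<close> of the leading and trailing exponents are additive in \<open>n\<close>, so the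
  difference of their weights is a linear function of \<open>n\<close>. It is bounded below on all of \<open>\<int>\<close>,
  hence zero, and \<open>u = v\<close> by injectivity of the weight. Here it matters that negative \<open>n\<close>
  occur and that the weights are real: in the lexicographic order an infinitesimal
  positive slope would survive. Dividing \<open>h n\<close> by the monomial of exponent \<open>u n\<close> reduces to the
  case of constant leading and trailing exponents.
\<close>

lemma geometric_ratio_monomial:
  fixes h :: "int \<Rightarrow> 'f::field W"
  assumes nz: "\<And>n. h n \<noteq> 0"
    and mult: "\<And>i j. \<exists>c. h i * h j = W_scale c (h 0 * h (i + j))"
  obtains c a i where "h 1 = W_scale c (W_basis a i * h 0)"
proof -
  obtain w :: "int \<times> int \<Rightarrow> real" where w: "Modules.additive w" "inj w"
    by (rule additive_real_weight_exists)
  have w': "Modules.additive (\<lambda>k. - w k)" "inj (\<lambda>k. - w k)"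
    using w by (auto simp: Modules.additive_def inj_def)
  have "\<forall>n. \<exists>p. leading w (h n) p" using leading_exists nz w(2) by blast
  then obtain p where p: "\<And>n. leading w (h n) (p n)" by metis
  have "\<forall>n. \<exists>p. leading (\<lambda>k. - w k) (h n) p" using leading_exists nz w'(2) by metis
  then obtain l where l: "\<And>n. leading (\<lambda>k. - w k) (h n) (l n)" by metis
  define u where "u n = p n - p 0" for n
  define v where "v n = l n - l 0" for n
  have u_add: "u (i + j) = u i + u j" for i j
    using geometric_leading[OF w(1) nz mult p, of i j] by (simp add: u_def algebra_simps)
  have v_add: "v (i + j) = v i + v j" for i j
    using geometric_leading[where w = "\<lambda>k. - w k", OF w'(1) nz mult l, of i j]
    by (simp add: v_def algebra_simps)
  define \<phi> where "\<phi> n = w (u n) - w (v n)" for n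
  have \<phi>: "\<phi> n = of_int n * \<phi> 1" for n
    by (rule additive_int_real)
      (simp add: Modules.additive_def \<phi>_def u_add v_add Modules.additive.add[OF w(1)])
  have "of_int n * \<phi> 1 \<ge> w (l 0) - w (p 0)" for n
  proof -
    have "w (l n) \<le> w (p n)" by (rule leading_le[OF p leading_in_keys[OF l]])
    then show ?thesis
      by (simp add: \<phi>_def[of n] u_def v_def Modules.additive.diff[OF w(1)] flip: \<phi>)
  qed
  then have "\<phi> 1 = 0" by (rule linear_bounded_below_imp_slope_zero)
  then have "w (u n) = w (v n)" for n using \<phi>[of n] by (simp add: \<phi>_def)
  then have uv: "v n = u n" for n using w(2) by (metis injD)
  define g where "g n = Poly_Mapping.single (- u n) 1 * h n" for n
  have u0: "u 0 = 0" by (simp add: u_def)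
  have g0: "g 0 = h 0" by (simp add: g_def u0)
  have single: "leading w' (Poly_Mapping.single k (1::'f)) k" for k and w' :: "int \<times> int \<Rightarrow> real"
    by (simp add: leading_def)
  have gp: "leading w (g n) (p 0)" for n
    using leading_mult(1)[OF w(1) single p, of "- u n" n] by (simp add: g_def u_def)
  have "leading (\<lambda>k. - w k) (g n) (l 0)" for n
    using leading_mult(1)[OF w'(1) single l, of "- v n" n] by (simp add: g_def v_def flip: uv)
  then have gl: "w (l 0) \<le> w k" if "k \<in> Poly_Mapping.keys (g n)" for n k
    using leading_le that by fastforce
  have "\<exists>c. g i * g j = W_scale c (g 0 * g (i + j))" for i j
  proof -
    obtain c where c: "h i * h j = W_scale c (h 0 * h (i + j))" using mult by blast
    have "g i * g j = Poly_Mapping.single (- u (i + j)) 1 * (h i * h j)"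
      by (simp add: g_def u_add mult.assoc mult.left_commute[of _ "h i"] mult_single
          add.commute flip: mult.assoc[of "Poly_Mapping.single _ _" "Poly_Mapping.single _ _"])
    then show ?thesis unfolding c g0 by (auto simp: g_def W_scale_mult mult.left_commute)
  qed
  then have "\<exists>c. g 0 = W_scale c (g 1)"
    using geometric_ratio_monomial_balanced[of w g, OF w _ gp] gl by blast
  then obtain c where c: "h 0 = W_scale c (g 1)" by (auto simp: g0)
  obtain a i where ai: "u 1 = (a, i)" by force
  have "c \<noteq> 0" using c nz[of 0] by auto
  have "W_basis a i * h 0 = W_scale c (Poly_Mapping.single (u 1) 1 * Poly_Mapping.single (- u 1) 1 * h 1)"
    by (simp add: c g_def W_basis_def ai W_scale_mult mult.assoc)
  also have "\<dots> = W_scale c (h 1)" by (simp add: mult_single)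
  finally have "h 1 = W_scale (1 / c) (W_basis a i * h 0)" using \<open>c \<noteq> 0\<close> by simp
  then show thesis by (rule that)
qed

section \<open>Elements with all integers as eigenvalues\<close>

text \<open>
  Leading exponents of \<open>f\<close> and \<open>B\<close> add up to that of \<open>1\<close>, so that of \<open>f\<close> has first component
  zero; the same holds for the reversed lexicographic order. All exponents of \<open>f\<close> lie between
  these two.
\<close>

lemma fst_zero_if_inverse_fst_zero:
  fixes f B :: "'f::field W"
  assumes fB: "f * B = 1" and B: "\<And>k. k \<in> Poly_Mapping.keys B \<Longrightarrow> fst k = 0"
    and k: "k \<in> Poly_Mapping.keys f"
  shows "fst k = 0"
proof -
  have nz: "f \<noteq> 0" "B \<noteq> 0" using fB by auto
  have ex: "\<exists>p. leading w f p \<and> fst p = 0" if w: "Modules.additive w" "inj w"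
    for w :: "int \<times> int \<Rightarrow> int \<times> int"
  proof -
    obtain p b where p: "leading w f p" and b: "leading w B b"
      using leading_exists nz w(2) by metis
    have "leading w (1 :: 'f W) (p + b)" using leading_mult(1)[OF w(1) p b] by (simp add: fB)
    then have "p + b = 0" by (simp add: leading_def)
    then have "fst p + fst b = 0" by (simp add: prod_eq_iff)
    with B[OF leading_in_keys[OF b]] p have "fst p = 0" by auto
    with p show ?thesis by blast
  qed
  obtain p where p: "leading (\<lambda>k. k) f p" "fst p = 0"
    using ex[of "\<lambda>k. k"] by (auto simp: Modules.additive_def)
  obtain q where q: "leading (\<lambda>k. - k) f q" "fst q = 0"
    using ex[of "\<lambda>k. - k"] by (auto simp: Modules.additive_def inj_def)
  have "k \<le> p" "q \<le> k" using leading_le[OF p(1) k] leading_le[OF q(1) k] by simp_all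
  then show ?thesis using p(2) q(2) by (auto simp: less_eq_prod_def)
qed

text \<open>
  With \<open>h 1 = c m h 0\<close> for a monomial \<open>m\<close>, the eigenvector equation for \<open>h 1\<close> becomes
  \<open>h 0 * D m = m\<close>, where \<open>D m = m B\<close> and \<open>B\<close> is free of \<open>t\<close>.
\<close>

lemma all_integer_eigenvalues_imp_fst_zero:
  fixes g :: "int \<Rightarrow> 'f::field_char_0" and h :: "int \<Rightarrow> 'f W"
  assumes g: "Modules.additive g" "inj g" and nz: "\<And>n. h n \<noteq> 0"
    and h: "\<And>n. W_bracket g (h 0) (h n) = W_scale (of_int n) (h n)"
    and k: "k \<in> Poly_Mapping.keys (h 0)"
  shows "fst k = 0"
proof -
  let ?f = "h 0" and ?D = "deriv g"
  have "\<exists>c. h i * h j = W_scale c (?f * h (i + j))" for i j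
  proof -
    have "W_bracket g ?f (h (i + j)) = W_scale (of_int i + of_int j) (h (i + j))"
      using h[of "i + j"] by simp
    from eigenvector_mult[OF g nz nz h h this] show ?thesis by blast
  qed
  then obtain c a i where h1: "h 1 = W_scale c (W_basis a i * ?f)"
    using geometric_ratio_monomial nz by metis
  define m :: "'f W" where "m = W_basis a i"
  define B :: "'f W" where "B = W_scale (g a) 1 + W_scale (of_int i) (W_basis 0 (- 1))"
  have "c \<noteq> 0" "m \<noteq> 0" using h1 nz[of 1] by (auto simp: m_def)
  have Dm: "?D m = m * B"
    by (simp add: m_def B_def deriv_basis[OF g(1)] distrib_left W_scale_mult W_basis_mult)
  have "W_scale c (W_bracket g ?f (m * ?f)) = W_scale c (m * ?f)"
    using h[of 1] by (simp add: h1 m_def W_bracket_scale_right)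
  then have "W_bracket g ?f (m * ?f) = m * ?f" using \<open>c \<noteq> 0\<close> by simp
  then have "?f * m * (?f * B) = ?f * m * 1"
    by (simp add: W_bracket_eq_wronskian[OF g(1)] deriv_mult[OF g(1)] Dm algebra_simps)
  then have "?f * B = 1" using nz[of 0] \<open>m \<noteq> 0\<close> by (metis mult_left_cancel no_zero_divisors)
  moreover have "fst k = 0" if "k \<in> Poly_Mapping.keys B" for k
    using that
    by (auto simp: in_keys_iff B_def lookup_add W_basis_def lookup_single when_def split: if_splits
        simp flip: W_basis_0_0)
  ultimately show ?thesis using fst_zero_if_inverse_fst_zero k by blast
qed

text \<open>
  The automorphism transports the eigenvectors \<open>(0, n + 1)\<close> of \<open>(0, 1)\<close> with eigenvalue \<open>n\<close>.
\<close>

theorem theorem2: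
  fixes g :: "int \<Rightarrow> 'f::field_char_0"
    and \<theta> :: "'f W \<Rightarrow> 'f W"
  assumes "Modules.additive g"
    and "inj g"
    and "lie_automorphism W_scale (W_bracket g) \<theta>"
  shows "\<exists>C :: int \<Rightarrow> 'f. finite {j. C j \<noteq> 0} \<and>
    \<theta> (W_basis 0 1) = (\<Sum>j | C j \<noteq> 0. W_scale (C j) (W_basis 0 j))"
proof -
  have lin: "Vector_Spaces.linear W_scale W_scale \<theta>" and "bij \<theta>"
    and br: "\<theta> (W_bracket g x y) = W_bracket g (\<theta> x) (\<theta> y)" for x y
    using assms(3) by (auto simp: lie_automorphism_def)
  have scale: "\<theta> (W_scale c x) = W_scale c (\<theta> x)" for c x
    using lin by (simp add: Vector_Spaces.linear_def module_hom_def module_hom_axioms_def)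
  have "\<theta> 0 = 0" using scale[of 0 0] by simp
  define f where "f = \<theta> (W_basis 0 1)"
  have fst0: "fst k = 0" if "k \<in> Poly_Mapping.keys f" for k
  proof (rule all_integer_eigenvalues_imp_fst_zero[OF assms(1,2)])
    show "\<theta> (W_basis 0 (n + 1)) \<noteq> 0" for n
    proof
      assume "\<theta> (W_basis 0 (n + 1)) = 0"
      then have "W_basis 0 (n + 1) = (0 :: 'f W)"
        using \<open>\<theta> 0 = 0\<close> \<open>bij \<theta>\<close> by (metis bij_pointE)
      then have "Poly_Mapping.lookup (W_basis 0 (n + 1) :: 'f W) (0, n + 1) = 0" by simp
      then show False by (simp add: W_basis_def)
    qed
    show "W_bracket g (\<theta> (W_basis 0 (0 + 1))) (\<theta> (W_basis 0 (n + 1)))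
        = W_scale (of_int n) (\<theta> (W_basis 0 (n + 1)))" for n
      by (simp add: W_bracket_basis add.commute flip: br scale)
    show "k \<in> Poly_Mapping.keys (\<theta> (W_basis 0 (0 + 1)))" using that by (simp add: f_def)
  qed
  define C where "C j = Poly_Mapping.lookup f (0, j)" for j
  have fin: "finite {j. C j \<noteq> 0}"
  proof (rule finite_subset)
    show "{j. C j \<noteq> 0} \<subseteq> snd ` Poly_Mapping.keys f" by (force simp: C_def in_keys_iff)
  qed simp
  have "f = (\<Sum>j | C j \<noteq> 0. W_scale (C j) (W_basis 0 j))"
  proof (rule poly_mapping_eqI)
    fix k :: "int \<times> int"
    obtain a i where k: "k = (a, i)" by force
    have "Poly_Mapping.lookup (\<Sum>j | C j \<noteq> 0. W_scale (C j) (W_basis 0 j)) k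
        = (\<Sum>j | C j \<noteq> 0. if j = i then (C i when a = 0) else 0)"
      by (auto simp: lookup_sum k W_basis_def lookup_single when_def intro!: sum.cong)
    also have "\<dots> = (C i when a = 0)" using fin by (auto simp: when_def)
    also have "\<dots> = Poly_Mapping.lookup f k"
      using fst0[of k] by (auto simp: C_def k when_def in_keys_iff)
    finally show "Poly_Mapping.lookup f k
      = Poly_Mapping.lookup (\<Sum>j | C j \<noteq> 0. W_scale (C j) (W_basis 0 j)) k" ..
  qed
  with fin show ?thesis unfolding f_def by blast
qed

end
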